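(* Let $T>0$, let $p:[0,T]\to(1,\infty)$ be continuous with $p(0)=p(T)$, let $f:[0,\infty)\to\mathbb{R}$ and $g:(0,\infty)\to\mathbb{R}$ be continuous, and let $h:[0,T]\to\mathbb{R}$ be continuous. Consider the periodic problem $$(\phi_{p(t)}(u'))'+f(u)u'+g(u)=h(t)\ \text{ in }[0,T],\qquad u(0)-u(T)=0=u'(0)-u'(T).$$ If this problem has a lower solution $\alpha$ and an upper solution $\beta$ such that $\alpha(t)\leq\beta(t)$ for all $t\in[0,T]$, then it has a solution $u$ with $\alpha(t)\leq u(t)\leq\beta(t)$ for all $t\in[0,T]$.
   Context: For $t\in[0,T]$ and $x\in\mathbb{R}$, $\phi_{p(t)}(x)=|x|^{p(t)-2}x$ (with $\phi_{p(t)}(0)=0$). A solution of the problem is a function $u:[0,T]\to(0,\infty)$ of class $C^1$ with $u(0)=u(T)$, $u'(0)=u'(T)$, such that $t\mapsto\phi_{p(t)}(u'(t))$ is of class $C^1$ on $[0,T]$ and the differential equation holds at every $t\in[0,T]$. A lower solution of the problem is a $C^1$ function $\alpha:[0,T]\to(0,\infty)$ such that $t\mapsto\phi_{p(t)}(\alpha'(t))$ is of class $C^1$ on $[0,T]$, $\alpha(0)=\alpha(T)$, $\alpha'(0)\geq\alpha'(T)$, and $(\phi_{p(t)}(\alpha'(t)))'+f(\alpha(t))\alpha'(t)+g(\alpha(t))\geq h(t)$ for all $t\in[0,T]$. An upper solution of the problem is a $C^1$ function $\beta:[0,T]\to(0,\infty)$ such that $t\mapsto\phi_{p(t)}(\beta'(t))$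 is of class $C^1$ on $[0,T]$, $\beta(0)=\beta(T)$, $\beta'(0)\leq\beta'(T)$, and $(\phi_{p(t)}(\beta'(t)))'+f(\beta(t))\beta'(t)+g(\beta(t))\leq h(t)$ for all $t\in[0,T]$. *)

theory Defs
  imports "HOL-Analysis.Analysis"
begin

text \<open>
  A function on \<open>[0, T]\<close> is a total function \<open>real \<Rightarrow> real\<close> of which only the values on
  \<open>{0..T}\<close> matter. Accordingly all derivatives are taken within \<open>{0..T}\<close>, so that they
  are one-sided at the two end points.
\<close>

abbreviation dI :: "real \<Rightarrow> (real \<Rightarrow> real) \<Rightarrow> real \<Rightarrow> real" where
  "dI T u t \<equiv> vector_derivative u (at t within {0..T})"

text \<open>
  The library predicate \<open>C1_differentiable_on\<close> asks for two-sided derivatives at the end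
  points as well, and hence depends on values outside \<open>[0, T]\<close>.
\<close>

definition C1_on_interval :: "real \<Rightarrow> (real \<Rightarrow> real) \<Rightarrow> bool" where
  "C1_on_interval T u \<longleftrightarrow>
     u differentiable_on {0..T} \<and> continuous_on {0..T} (dI T u)"

text \<open>Since \<open>0 powr a = 0\<close> and because of the factor \<open>x\<close>, \<open>\<phi> q 0 = 0\<close> for every \<open>q\<close>.\<close>

definition \<phi> :: "real \<Rightarrow> real \<Rightarrow> real" where
  "\<phi> q x = \<bar>x\<bar> powr (q - 2) * x"

definition flux :: "real \<Rightarrow> (real \<Rightarrow> real) \<Rightarrow> (real \<Rightarrow> real) \<Rightarrow> real \<Rightarrow> real" where
  "flux T p u t = \<phi> (p t) (dI T u t)"

definition is_solution ::
  "real \<Rightarrow> (real \<Rightarrow> real) \<Rightarrow> (real \<Rightarrow> real) \<Rightarrow> (real \<Rightarrow> real) \<Rightarrow> (real \<Rightarrow> real) \<Rightarrow> (real \<Rightarrow> real) \<Rightarrow> bool"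
where
  "is_solution T p f g h u \<longleftrightarrow>
     (\<forall>t\<in>{0..T}. u t > 0) \<and>
     C1_on_interval T u \<and> C1_on_interval T (flux T p u) \<and>
     u 0 = u T \<and> dI T u 0 = dI T u T \<and>
     (\<forall>t\<in>{0..T}. dI T (flux T p u) t + f (u t) * dI T u t + g (u t) = h t)"

definition lower_solution ::
  "real \<Rightarrow> (real \<Rightarrow> real) \<Rightarrow> (real \<Rightarrow> real) \<Rightarrow> (real \<Rightarrow> real) \<Rightarrow> (real \<Rightarrow> real) \<Rightarrow> (real \<Rightarrow> real) \<Rightarrow> bool"
where
  "lower_solution T p f g h \<alpha> \<longleftrightarrow>
     (\<forall>t\<in>{0..T}. \<alpha> t > 0) \<and>
     C1_on_interval T \<alpha> \<and> C1_on_interval T (flux T p \<alpha>) \<and>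
     \<alpha> 0 = \<alpha> T \<and> dI T \<alpha> 0 \<ge> dI T \<alpha> T \<and>
     (\<forall>t\<in>{0..T}. dI T (flux T p \<alpha>) t + f (\<alpha> t) * dI T \<alpha> t + g (\<alpha> t) \<ge> h t)"

definition upper_solution ::
  "real \<Rightarrow> (real \<Rightarrow> real) \<Rightarrow> (real \<Rightarrow> real) \<Rightarrow> (real \<Rightarrow> real) \<Rightarrow> (real \<Rightarrow> real) \<Rightarrow> (real \<Rightarrow> real) \<Rightarrow> bool"
where
  "upper_solution T p f g h \<beta> \<longleftrightarrow>
     (\<forall>t\<in>{0..T}. \<beta> t > 0) \<and>
     C1_on_interval T \<beta> \<and> C1_on_interval T (flux T p \<beta>) \<and>
     \<beta> 0 = \<beta> T \<and> dI T \<beta> 0 \<le> dI T \<beta> T \<and>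
     (\<forall>t\<in>{0..T}. dI T (flux T p \<beta>) t + f (\<beta> t) * dI T \<beta> t + g (\<beta> t) \<le> h t)"

end

theory Submission
  imports Defs "HOL-Complex_Analysis.Great_Picard"
begin

text \<open>
  The method of lower and upper solutions. Let \<open>F\<close> be a primitive of \<open>f\<close>, and let \<open>\<gamma> t u\<close> be \<open>u\<close>
  clipped to the interval from \<open>\<alpha> t\<close> to \<open>\<beta> t\<close>. The equation is first modified to
  \<open>(\<phi> (p t) u' + F (\<gamma> t u))' + g (\<gamma> t u) = h t + r (u - \<gamma> t u)\<close>,
  where \<open>r\<close> is the identity truncated at a large constant. Inside the strip between \<open>\<alpha>\<close> and \<open>\<beta>\<close>
  this is the original equation.

  Every periodic solution of the modified equation lies in the strip. Where \<open>u > \<beta>\<close>, the term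
  \<open>F (\<gamma> t u)\<close> equals \<open>F (\<beta> t)\<close>, so comparison with the inequality for \<open>\<beta>\<close> shows that the
  difference of the fluxes of \<open>u\<close> and \<open>\<beta>\<close> is strictly increasing. As \<open>\<phi> q\<close> is increasing, this
  difference has the sign of \<open>u' - \<beta>'\<close>, and \<open>u - \<beta>\<close> cannot have a positive maximum
  (\<open>periodic_maximum_principle\<close>). The lower bound is symmetric. Putting the friction inside the
  derivative as \<open>F (\<gamma> t u)\<close> serves two purposes: it cancels in this comparison, and it removes
  the unbounded term \<open>f u * u'\<close> from the equation.

  For existence, the Lienard variable \<open>w = \<phi> (p t) u' + F (\<gamma> t u)\<close> turns the modified equation into a
  planar system \<open>u' = \<psi> (p t) (w - F (\<gamma> t u))\<close>, \<open>w' = H t u\<close>, where \<open>\<psi> q\<close> is the inverse of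
  \<open>\<phi> q\<close> and \<open>H\<close> is bounded. Its right-hand side is merely continuous, so the period map need not
  exist; it is replaced by that of the Euler scheme with \<open>N\<close> steps, which is continuous. On a
  large rectangle \<open>u\<close> grows over a period if \<open>w\<close> starts large, and \<open>w\<close> grows if \<open>u\<close> starts large,
  with the reverse at the opposite edges. The Poincare-Miranda theorem, a form of Brouwer's
  theorem, then gives a closed Euler polygon (\<open>exists_periodic_euler_orbit\<close>). By the Arzela-Ascoli
  theorem, closed polygons on finer and finer grids accumulate at a periodic solution
  (\<open>periodic_solution_as_limit_of_euler\<close>).
\<close>

section \<open>The Poincare-Miranda theorem in the plane\<close>

text \<open>
  Clipping \<open>z - (P z, Q z)\<close> to the rectangle gives a continuous self-map, which has a fixed point
  by Brouwer's theorem. At the fixed point the clipping is inactive, for it would move the point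
  onto an edge on which the sign condition pushes the other way; so \<open>P\<close> and \<open>Q\<close> vanish there.
\<close>

lemma poincare_miranda:
  fixes P Q :: "real \<times> real \<Rightarrow> real"
  assumes "a \<ge> 0" "b \<ge> 0"
    and cont: "continuous_on ({-a..a} \<times> {-b..b}) P" "continuous_on ({-a..a} \<times> {-b..b}) Q"
    and right: "\<And>y. \<bar>y\<bar> \<le> b \<Longrightarrow> P (a, y) > 0"
    and left: "\<And>y. \<bar>y\<bar> \<le> b \<Longrightarrow> P (-a, y) < 0"
    and top: "\<And>x. \<bar>x\<bar> \<le> a \<Longrightarrow> Q (x, b) > 0"
    and bot: "\<And>x. \<bar>x\<bar> \<le> a \<Longrightarrow> Q (x, -b) < 0"
  shows "\<exists>z \<in> {-a..a} \<times> {-b..b}. P z = 0 \<and> Q z = 0"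
proof -
  define H where "H z = (max (-a) (min a (fst z - P z)), max (-b) (min b (snd z - Q z)))" for z
  obtain z where z: "z \<in> {-a..a} \<times> {-b..b}" "H z = z"
  proof (rule brouwer)
    show "compact ({-a..a} \<times> {-b..b})" by (intro compact_Times compact_Icc)
    show "convex ({-a..a} \<times> {-b..b})" by (intro convex_Times convex_real_interval)
    show "{-a..a} \<times> {-b..b} \<noteq> {}" using assms(1,2) by auto
    show "continuous_on ({-a..a} \<times> {-b..b}) H"
      unfolding H_def by (intro continuous_intros cont)
    show "H \<in> {-a..a} \<times> {-b..b} \<rightarrow> {-a..a} \<times> {-b..b}"
      using assms(1,2) by (auto simp: H_def)
  qed
  obtain x y where xy: "z = (x, y)" by force
  have x: "max (-a) (min a (x - P z)) = x" and y: "max (-b) (min b (y - Q z)) = y"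
    using z(2) unfolding H_def xy by auto
  have bd: "\<bar>x\<bar> \<le> a" "\<bar>y\<bar> \<le> b" using z(1) unfolding xy by auto
  have "P z = 0"
    using x bd left[OF bd(2)] right[OF bd(2)] unfolding xy
    by (cases "x = a"; cases "x = - a") (auto simp: max_def min_def split: if_splits)
  moreover have "Q z = 0"
    using y bd top[OF bd(1)] bot[OF bd(1)] unfolding xy
    by (cases "y = b"; cases "y = - b") (auto simp: max_def min_def split: if_splits)
  ultimately show ?thesis using z(1) by blast
qed

section \<open>Euler polygons and their limits\<close>

primrec euler :: "real \<Rightarrow> (real \<Rightarrow> 'a \<Rightarrow> 'a) \<Rightarrow> 'a \<Rightarrow> nat \<Rightarrow> 'a::real_vector" where
  "euler d X z 0 = z"
| "euler d X z (Suc k) = euler d X z k + d *\<^sub>R X (real k * d) (euler d X z k)"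

text \<open>
  The derivative of the Euler polygon. The polygons themselves are recovered by integration, which
  spares the discussion of their corners.
\<close>

definition euler_slope :: "real \<Rightarrow> (real \<Rightarrow> 'a \<Rightarrow> 'a) \<Rightarrow> 'a \<Rightarrow> real \<Rightarrow> 'a::real_vector" where
  "euler_slope d X z s = (let k = nat \<lfloor>s / d\<rfloor> in X (real k * d) (euler d X z k))"

text \<open>
  For merely continuous \<open>X\<close> the initial value problem may have many solutions, and there is no
  period map. The end point of an Euler polygon, however, always depends continuously on the
  initial point, as a composition of finitely many continuous maps.
\<close>

lemma continuous_on_euler:
  fixes X :: "real \<Rightarrow> 'a::real_normed_vector \<Rightarrow> 'a"
  assumes "continuous_on ({0..T} \<times> UNIV) (\<lambda>(t, z). X t z)" "d \<ge> 0" "real k * d \<le> T"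
  shows "continuous_on UNIV (\<lambda>z. euler d X z k)"
  using assms(3)
proof (induction k)
  case (Suc k)
  have k: "real k * d \<le> T" "0 \<le> real k * d" using Suc.prems assms(2) by (auto simp: algebra_simps)
  have "continuous_on UNIV ((\<lambda>(t, z). X t z) \<circ> (\<lambda>z. (real k * d, euler d X z k)))"
    using k Suc.IH
    by (intro continuous_on_compose continuous_intros continuous_on_subset[OF assms(1)]) auto
  then show ?case using Suc.IH k by (auto intro!: continuous_intros simp: o_def)
qed simp

lemma floor_grid:
  fixes d s :: real
  assumes "d > 0" "0 \<le> s"
  shows "real (nat \<lfloor>s / d\<rfloor>) * d \<le> s" "s < real (nat \<lfloor>s / d\<rfloor>) * d + d"
proof -
  have "real (nat \<lfloor>s / d\<rfloor>) = of_int \<lfloor>s / d\<rfloor>" using assms by simp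
  then show "real (nat \<lfloor>s / d\<rfloor>) * d \<le> s" "s < real (nat \<lfloor>s / d\<rfloor>) * d + d"
    using floor_divide_lower[OF assms(1), of s] floor_divide_upper[OF assms(1), of s]
    by (simp_all add: distrib_right)
qed

lemma euler_has_integral:
  fixes X :: "real \<Rightarrow> 'a::euclidean_space \<Rightarrow> 'a"
  assumes "d > 0"
  shows "(euler_slope d X z has_integral (euler d X z k - z)) {0..real k * d}"
proof (induction k)
  case 0
  then show ?case by (simp add: has_integral_refl)
next
  case (Suc k)
  let ?v = "X (real k * d) (euler d X z k)"
  have "(euler_slope d X z has_integral (d *\<^sub>R ?v)) {real k * d..real (Suc k) * d}"
  proof (rule has_integral_spike_finite[where S = "{real (Suc k) * d}"])
    show "((\<lambda>_. ?v) has_integral d *\<^sub>R ?v) {real k * d..real (Suc k) * d}"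
      using has_integral_const_real[of ?v "real k * d" "real (Suc k) * d"] assms
      by (simp add: algebra_simps)
    fix s assume "s \<in> {real k * d..real (Suc k) * d} - {real (Suc k) * d}"
    then have "real k \<le> s / d" "s / d < real k + 1" using assms by (auto simp: field_simps)
    then have "\<lfloor>s / d\<rfloor> = int k" by (simp add: floor_unique)
    then show "euler_slope d X z s = ?v" by (simp add: euler_slope_def)
  qed simp
  moreover have "0 \<le> real k * d" "real k * d \<le> real (Suc k) * d" using assms by auto
  ultimately have "(euler_slope d X z has_integral ((euler d X z k - z) + d *\<^sub>R ?v)) {0..real (Suc k) * d}"
    using Suc.IH has_integral_combine by blast
  then show ?case by (simp add: algebra_simps)
qed

text \<open>
  The Peano existence argument, applied to closed polygons. A bounded field makes the Euler polygons
  uniformly Lipschitz, so the Arzela-Ascoli theorem yields a uniform limit along finer and finer grids.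
  Each polygon is the integral of its slopes, and the slopes converge pointwise to
  \<open>X s (x s)\<close>; by dominated convergence the limit satisfies the integral equation. It inherits
  closedness from the polygons.
\<close>

lemma periodic_solution_as_limit_of_euler:
  fixes X :: "real \<Rightarrow> 'a::euclidean_space \<Rightarrow> 'a"
  assumes T: "T > 0"
    and cont: "continuous_on ({0..T} \<times> UNIV) (\<lambda>(t, z). X t z)"
    and bound: "\<And>t z. t \<in> {0..T} \<Longrightarrow> norm (X t z) \<le> L"
    and C: "compact C" "\<And>n. z n \<in> C"
    and closed: "\<And>n. euler (T / Suc n) X (z n) (Suc n) = z n"
  obtains x where "x 0 \<in> C" "x T = x 0"
    "\<And>t. t \<in> {0..T} \<Longrightarrow> (x has_vector_derivative X t (x t)) (at t within {0..T})"
proof -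
  define d where "d n = T / real (Suc n)" for n
  define v where "v n = euler_slope (d n) X (z n)" for n
  define y where "y n t = z n + integral {0..t} (v n)" for n t
  \<comment> \<open>The grid point at or just before \<open>s\<close>, where the slope at \<open>s\<close> is evaluated.\<close>
  define gr where "gr n s = real (nat \<lfloor>s / d n\<rfloor>) * d n" for n s
  have d: "d n > 0" "real (Suc n) * d n = T" for n using T by (auto simp: d_def)
  have gr: "gr n s \<in> {0..T}" "\<bar>gr n s - s\<bar> \<le> d n" if "s \<in> {0..T}" for n s
    using floor_grid[OF d(1), of s n] d(1)[of n] that unfolding gr_def by auto
  have L: "L \<ge> 0" using norm_ge_zero[of "X 0 undefined"] bound[of 0 undefined] T
    by (meson atLeastAtMost_iff less_eq_real_def order_trans)
  have vb: "norm (v n s) \<le> L" if "s \<in> {0..T}" for n s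
    using bound[OF gr(1)[OF that, of n]] by (simp add: v_def euler_slope_def Let_def gr_def)
  have vint: "(v n has_integral (euler (d n) X (z n) k - z n)) {0..real k * d n}" for n k
    unfolding v_def by (rule euler_has_integral[OF d(1)])
  have vi: "v n integrable_on {a..b}" if "0 \<le> a" "b \<le> T" for n a b
    using integrable_subinterval_real[of "v n" 0 T a b] vint[of n "Suc n"] that
    unfolding d(2) by (auto simp: integrable_on_def)
  have ygrid: "y n (real k * d n) = euler (d n) X (z n) k" for n k
    using integral_unique[OF vint[of n k]] by (simp add: y_def)
  have ylip: "norm (y n s - y n t) \<le> L * \<bar>s - t\<bar>" if st: "s \<in> {0..T}" "t \<in> {0..T}" for n s t
  proof -
    have *: "norm (y n t - y n s) \<le> L * (t - s)" if "0 \<le> s" "s \<le> t" "t \<le> T" for s t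
    proof -
      have "integral {0..s} (v n) + integral {s..t} (v n) = integral {0..t} (v n)"
        using that vi[of 0 t] by (intro Henstock_Kurzweil_Integration.integral_combine) auto
      then have "y n t - y n s = integral {s..t} (v n)" by (simp add: y_def algebra_simps)
      moreover have "norm (integral {s..t} (v n)) \<le> L * (t - s)"
        using has_integral_bound_real[OF L, of "{}" "v n" "integral {s..t} (v n)" s t]
          integrable_integral[OF vi[of s t n]] vb[of _ n] that by auto
      ultimately show ?thesis by simp
    qed
    show ?thesis using *[of s t] *[of t s] st by (cases "s \<le> t") (auto simp: norm_minus_commute)
  qed
  obtain M where M: "\<And>n. norm (z n) \<le> M"
    using compact_imp_bounded[OF C(1)] C(2) unfolding bounded_iff by blast
  obtain x r where x: "continuous_on {0..T} x" and r: "strict_mono (r :: nat \<Rightarrow> nat)"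
    and lim: "\<And>e. 0 < e \<Longrightarrow> \<exists>N. \<forall>n t. n \<ge> N \<and> t \<in> {0..T} \<longrightarrow> norm (y (r n) t - x t) < e"
  proof (rule Arzela_Ascoli[of "{0..T}" y "M + L * T"])
    fix n t assume t: "t \<in> {0..T}"
    have "norm (y n t) \<le> norm (y n 0) + norm (y n t - y n 0)"
      by (metis add.commute norm_triangle_sub)
    also have "\<dots> \<le> M + L * t" using ylip[of t 0 n] t T M[of n] by (simp add: y_def)
    also have "\<dots> \<le> M + L * T" using t L by (simp add: mult_left_mono)
    finally show "norm (y n t) \<le> M + L * T" .
  next
    fix t e :: real assume te: "t \<in> {0..T}" "0 < e"
    show "\<exists>d>0. \<forall>n s. s \<in> {0..T} \<and> norm (t - s) < d \<longrightarrow> norm (y n t - y n s) < e"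
    proof (intro exI conjI allI impI)
      show "e / (L + 1) > 0" using te L by simp
      fix n s assume s: "s \<in> {0..T} \<and> norm (t - s) < e / (L + 1)"
      have "norm (y n t - y n s) \<le> L * \<bar>t - s\<bar>" using ylip te s by blast
      also have "\<dots> \<le> (L + 1) * \<bar>t - s\<bar>" by (simp add: mult_right_mono)
      also have "\<dots> < e" using s L by (simp add: field_simps)
      finally show "norm (y n t - y n s) < e" .
    qed
  qed (simp, blast)
  have ptw: "(\<lambda>n. y (r n) t) \<longlonglongrightarrow> x t" if "t \<in> {0..T}" for t
    using lim that unfolding LIMSEQ_iff by blast
  have "d \<longlonglongrightarrow> 0" unfolding d_def by (rule LIMSEQ_Suc[OF lim_const_over_n])
  then have d0: "(\<lambda>n. d (r n)) \<longlonglongrightarrow> 0" using LIMSEQ_subseq_LIMSEQ[OF _ r] by (auto simp: o_def)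
  have vlim: "(\<lambda>n. v (r n) s) \<longlonglongrightarrow> X s (x s)" if s: "s \<in> {0..T}" for s
  proof -
    have g0: "(\<lambda>n. gr (r n) s - s) \<longlonglongrightarrow> 0"
      by (rule Lim_null_comparison[OF _ d0]) (use gr(2)[OF s] in auto)
    from tendsto_add[OF g0 tendsto_const[of s]] have g: "(\<lambda>n. gr (r n) s) \<longlonglongrightarrow> s" by simp
    have "(\<lambda>n. y (r n) (gr (r n) s) - y (r n) s) \<longlonglongrightarrow> 0"
    proof (rule Lim_null_comparison)
      show "\<forall>\<^sub>F n in sequentially. norm (y (r n) (gr (r n) s) - y (r n) s) \<le> L * \<bar>gr (r n) s - s\<bar>"
        using ylip[OF gr(1)[OF s] s] by auto
      show "(\<lambda>n. L * \<bar>gr (r n) s - s\<bar>) \<longlonglongrightarrow> 0"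
        using tendsto_mult[OF tendsto_const[of L] tendsto_rabs[OF g0]] by simp
    qed
    from tendsto_add[OF this ptw[OF s]] have "(\<lambda>n. y (r n) (gr (r n) s)) \<longlonglongrightarrow> x s" by simp
    then have "(\<lambda>n. (gr (r n) s, y (r n) (gr (r n) s))) \<longlonglongrightarrow> (s, x s)"
      using g by (rule tendsto_Pair[rotated])
    from continuous_on_tendsto_compose[OF cont this]
    have "(\<lambda>n. X (gr (r n) s) (y (r n) (gr (r n) s))) \<longlonglongrightarrow> X s (x s)" using s gr(1)[OF s] by auto
    moreover have "X (gr n s) (y n (gr n s)) = v n s" for n
      unfolding gr_def ygrid by (simp add: v_def euler_slope_def Let_def)
    ultimately show ?thesis by simp
  qed
  have cX: "continuous_on {0..T} (\<lambda>s. X s (x s))"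
  proof -
    have "continuous_on {0..T} ((\<lambda>(t, z). X t z) \<circ> (\<lambda>s. (s, x s)))"
      by (intro continuous_on_compose continuous_intros x continuous_on_subset[OF cont]) auto
    then show ?thesis by (simp add: o_def)
  qed
  have z0: "(\<lambda>n. z (r n)) \<longlonglongrightarrow> x 0" using ptw[of 0] T by (simp add: y_def)
  have xint: "x t = x 0 + integral {0..t} (\<lambda>s. X s (x s))" if t: "t \<in> {0..T}" for t
  proof -
    have "(\<lambda>n. integral {0..t} (v (r n))) \<longlonglongrightarrow> integral {0..t} (\<lambda>s. X s (x s))"
      by (rule dominated_convergence(2)[where h = "\<lambda>_. L"]) (use t vi vb vlim in auto)
    then have "(\<lambda>n. y (r n) t) \<longlonglongrightarrow> x 0 + integral {0..t} (\<lambda>s. X s (x s))"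
      unfolding y_def by (intro tendsto_add z0)
    then show ?thesis using ptw[OF t] LIMSEQ_unique by blast
  qed
  show ?thesis
  proof (rule that)
    show "x 0 \<in> C"
      using closed_sequentially[OF compact_imp_closed[OF C(1)] _ z0] C(2) by blast
    have "y n T = z n" for n
      using ygrid[of n "Suc n"] closed[of n] unfolding d(2) by (simp add: d_def del: euler.simps)
    then show "x T = x 0" using ptw[of T] T z0 LIMSEQ_unique by auto
    fix t assume t: "t \<in> {0..T}"
    have "((\<lambda>t. x 0 + integral {0..t} (\<lambda>s. X s (x s))) has_vector_derivative X t (x t)) (at t within {0..T})"
      using integral_has_vector_derivative[OF cX t]
      by (auto intro!: derivative_eq_intros)
    then show "(x has_vector_derivative X t (x t)) (at t within {0..T})"
      by (rule has_vector_derivative_transform[OF t, rotated]) (rule xint)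
  qed
qed

section \<open>Periodic solutions of planar systems\<close>

lemma real_recursion_drift:
  fixes a b :: "nat \<Rightarrow> real"
  assumes "\<And>k. k < n \<Longrightarrow> a (Suc k) = a k + d * b k" "\<And>k. k < n \<Longrightarrow> \<bar>b k\<bar> \<le> K"
    "d \<ge> 0" "k \<le> n"
  shows "\<bar>a k - a 0\<bar> \<le> K * (real k * d)"
  using assms(4)
proof (induction k)
  case (Suc k)
  have "\<bar>d * b k\<bar> \<le> d * K" using assms(2)[of k] assms(3) Suc.prems
    by (simp add: abs_mult mult_left_mono)
  then show ?case using Suc assms(1)[of k] by (auto simp: algebra_simps)
qed simp

lemma real_recursion_increase:
  fixes a b :: "nat \<Rightarrow> real"
  assumes "\<And>k. k < n \<Longrightarrow> a (Suc k) = a k + d * b k" "\<And>k. k < n \<Longrightarrow> b k > 0"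
    "d > 0" "n > 0"
  shows "a n > a 0"
proof -
  have "k < n \<Longrightarrow> a (Suc k) > a 0" for k
  proof (induction k)
    case 0
    then show ?case using assms(1)[of 0] assms(2)[of 0] assms(3) by simp
  next
    case (Suc k)
    have "d * b (Suc k) > 0" using assms(2)[of "Suc k"] assms(3) Suc.prems by simp
    then show ?case using assms(1)[of "Suc k"] Suc by simp
  qed
  then show ?thesis using assms(4) by (cases n) auto
qed

text \<open>
  Along an orbit \<open>u\<close> drifts by at most \<open>L * T\<close> and \<open>w\<close> by at most \<open>K * T\<close>. Starting at
  \<open>u = b + L * T\<close> therefore keeps \<open>u \<ge> b\<close> all the time, so \<open>w\<close> increases at every step and
  ends higher than it began; the other three edges are similar. This is the sign pattern of
  \<open>poincare_miranda\<close> for the displacement over one period.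
\<close>

lemma exists_periodic_euler_orbit:
  fixes X :: "real \<Rightarrow> real \<times> real \<Rightarrow> real \<times> real"
  assumes T: "T > 0"
    and cont: "continuous_on ({0..T} \<times> UNIV) (\<lambda>(t, z). X t z)"
    and L: "\<And>t z. t \<in> {0..T} \<Longrightarrow> \<bar>fst (X t z)\<bar> \<le> L"
    and K: "\<And>t z. t \<in> {0..T} \<Longrightarrow> \<bar>snd (X t z)\<bar> \<le> K"
    and right: "\<And>t u w. t \<in> {0..T} \<Longrightarrow> u \<ge> b \<Longrightarrow> snd (X t (u, w)) > 0"
    and left: "\<And>t u w. t \<in> {0..T} \<Longrightarrow> u \<le> -b \<Longrightarrow> snd (X t (u, w)) < 0"
    and top: "\<And>t u w. t \<in> {0..T} \<Longrightarrow> w \<ge> a \<Longrightarrow> fst (X t (u, w)) > 0"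
    and bot: "\<And>t u w. t \<in> {0..T} \<Longrightarrow> w \<le> -a \<Longrightarrow> fst (X t (u, w)) < 0"
    and ab: "a \<ge> 0" "b \<ge> 0"
  shows "\<exists>z \<in> {-(b + L * T)..b + L * T} \<times> {-(a + K * T)..a + K * T}.
    euler (T / Suc n) X z (Suc n) = z"
proof -
  define d where "d = T / Suc n"
  define E where "E = (\<lambda>z k. euler d X z k)"
  have d: "d > 0" "real (Suc n) * d = T" using T by (auto simp: d_def)
  have LK: "L \<ge> 0" "K \<ge> 0" using L[of 0 0] K[of 0 0] T by auto
  have kd: "real k * d \<in> {0..T}" if "k \<le> Suc n" for k
    using mult_right_mono[of "real k" "real (Suc n)" d] that d by auto
  have r1: "fst (E z (Suc k)) = fst (E z k) + d * fst (X (real k * d) (E z k))"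
   and r2: "snd (E z (Suc k)) = snd (E z k) + d * snd (X (real k * d) (E z k))" for z k
    by (simp_all add: E_def)
  have E0: "E z 0 = z" for z by (simp add: E_def)
  have d1: "\<bar>fst (E z k) - fst z\<bar> \<le> L * T" if "k \<le> Suc n" for z k
  proof -
    have "\<bar>fst (E z k) - fst z\<bar> \<le> L * (real k * d)"
      using real_recursion_drift[of "Suc n" "\<lambda>k. fst (E z k)" d "\<lambda>k. fst (X (real k * d) (E z k))" L k]
        that kd L d by (simp add: r1 E0)
    also have "\<dots> \<le> L * T" using kd[OF that] LK by (intro mult_left_mono) auto
    finally show ?thesis .
  qed
  have d2: "\<bar>snd (E z k) - snd z\<bar> \<le> K * T" if "k \<le> Suc n" for z k
  proof -
    have "\<bar>snd (E z k) - snd z\<bar> \<le> K * (real k * d)"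
      using real_recursion_drift[of "Suc n" "\<lambda>k. snd (E z k)" d "\<lambda>k. snd (X (real k * d) (E z k))" K k]
        that kd K d by (simp add: r2 E0)
    also have "\<dots> \<le> K * T" using kd[OF that] LK by (intro mult_left_mono) auto
    finally show ?thesis .
  qed
  have incr: "snd (E z (Suc n)) > snd z" if "fst z = b + L * T" for z
  proof -
    have "snd (X (real k * d) (E z k)) > 0" if "k < Suc n" for k
      using right[of "real k * d" "fst (E z k)" "snd (E z k)"] kd[of k] d1[of k z] that \<open>fst z = _\<close> by auto
    from real_recursion_increase[of "Suc n" "\<lambda>k. snd (E z k)" d, OF r2 this] d E0 show ?thesis by simp
  qed
  have decr: "snd (E z (Suc n)) < snd z" if "fst z = - (b + L * T)" for z
  proof -
    have "- snd (X (real k * d) (E z k)) > 0" if "k < Suc n" for k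
      using left[of "real k * d" "fst (E z k)" "snd (E z k)"] kd[of k] d1[of k z] that \<open>fst z = _\<close> by auto
    from real_recursion_increase[of "Suc n" "\<lambda>k. - snd (E z k)" d
        "\<lambda>k. - snd (X (real k * d) (E z k))"] this d E0 show ?thesis
      by (simp add: r2)
  qed
  have incr': "fst (E z (Suc n)) > fst z" if "snd z = a + K * T" for z
  proof -
    have "fst (X (real k * d) (E z k)) > 0" if "k < Suc n" for k
      using top[of "real k * d" "snd (E z k)" "fst (E z k)"] kd[of k] d2[of k z] that \<open>snd z = _\<close> by auto
    from real_recursion_increase[of "Suc n" "\<lambda>k. fst (E z k)" d, OF r1 this] d E0 show ?thesis by simp
  qed
  have decr': "fst (E z (Suc n)) < fst z" if "snd z = - (a + K * T)" for z
  proof -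
    have "- fst (X (real k * d) (E z k)) > 0" if "k < Suc n" for k
      using bot[of "real k * d" "snd (E z k)" "fst (E z k)"] kd[of k] d2[of k z] that \<open>snd z = _\<close> by auto
    from real_recursion_increase[of "Suc n" "\<lambda>k. - fst (E z k)" d
        "\<lambda>k. - fst (X (real k * d) (E z k))"] this d E0 show ?thesis
      by (simp add: r1)
  qed
  let ?B = "{-(b + L * T)..b + L * T} \<times> {-(a + K * T)..a + K * T}"
  have cE: "continuous_on ?B (\<lambda>z. E z (Suc n))"
    unfolding E_def using continuous_on_euler[OF cont, of d "Suc n"] d
    by (auto intro: continuous_on_subset)
  have cP: "continuous_on ?B (\<lambda>z. snd (E z (Suc n)) - snd z)"
    and cQ: "continuous_on ?B (\<lambda>z. fst (E z (Suc n)) - fst z)"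
    by (intro continuous_intros cE)+
  \<comment> \<open>The change of \<open>w\<close> is controlled on the edges where \<open>u\<close> is extreme, and the change of
    \<open>u\<close> on those where \<open>w\<close> is.\<close>
  have "\<exists>z\<in>?B. snd (E z (Suc n)) - snd z = 0 \<and> fst (E z (Suc n)) - fst z = 0"
    by (rule poincare_miranda[OF _ _ cP cQ]) (use ab LK T incr decr incr' decr' in auto)
  then show ?thesis unfolding E_def d_def by (auto simp: prod_eq_iff simp del: euler.simps)
qed

text \<open>
  The bound on \<open>w\<close> holds because \<open>w\<close> starts in the rectangle of
  \<open>exists_periodic_euler_orbit\<close> and drifts by at most \<open>K * T\<close>. It does not involve \<open>L\<close>. This makes it possible to truncate the first
  component of a field at a level chosen after \<open>a\<close> and \<open>K\<close>, and to find that the truncation is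
  inactive along the periodic solution.
\<close>

lemma planar_periodic_solution:
  fixes X :: "real \<Rightarrow> real \<times> real \<Rightarrow> real \<times> real"
  assumes T: "T > 0"
    and cont: "continuous_on ({0..T} \<times> UNIV) (\<lambda>(t, z). X t z)"
    and L: "\<And>t z. t \<in> {0..T} \<Longrightarrow> \<bar>fst (X t z)\<bar> \<le> L"
    and K: "\<And>t z. t \<in> {0..T} \<Longrightarrow> \<bar>snd (X t z)\<bar> \<le> K"
    and right: "\<And>t u w. t \<in> {0..T} \<Longrightarrow> u \<ge> b \<Longrightarrow> snd (X t (u, w)) > 0"
    and left: "\<And>t u w. t \<in> {0..T} \<Longrightarrow> u \<le> -b \<Longrightarrow> snd (X t (u, w)) < 0"
    and top: "\<And>t u w. t \<in> {0..T} \<Longrightarrow> w \<ge> a \<Longrightarrow> fst (X t (u, w)) > 0"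
    and bot: "\<And>t u w. t \<in> {0..T} \<Longrightarrow> w \<le> -a \<Longrightarrow> fst (X t (u, w)) < 0"
    and ab: "a \<ge> 0" "b \<ge> 0"
  obtains u w where "u T = u 0" "w T = w 0"
    "\<And>t. t \<in> {0..T} \<Longrightarrow> (u has_real_derivative fst (X t (u t, w t))) (at t within {0..T})"
    "\<And>t. t \<in> {0..T} \<Longrightarrow> (w has_real_derivative snd (X t (u t, w t))) (at t within {0..T})"
    "\<And>t. t \<in> {0..T} \<Longrightarrow> \<bar>w t\<bar> \<le> a + 2 * K * T"
proof -
  define C where "C = {-(b + L * T)..b + L * T} \<times> {-(a + K * T)..a + K * T}"
  have "\<exists>z \<in> C. euler (T / Suc n) X z (Suc n) = z" for n
    unfolding C_def by (rule exists_periodic_euler_orbit[OF T cont]) (fact assms)+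
  then obtain z where z: "\<And>n. z n \<in> C" "\<And>n. euler (T / Suc n) X (z n) (Suc n) = z n"
    by metis
  have "compact C" unfolding C_def by (intro compact_Times compact_Icc)
  moreover have "norm (X t z) \<le> L + K" if "t \<in> {0..T}" for t z
    using norm_Pair_le[of "fst (X t z)" "snd (X t z)"] L[OF that, of z] K[OF that, of z] by simp
  ultimately obtain x where x: "x 0 \<in> C" "x T = x 0"
    and dx: "\<And>t. t \<in> {0..T} \<Longrightarrow> (x has_vector_derivative X t (x t)) (at t within {0..T})"
    using periodic_solution_as_limit_of_euler[OF T cont _ _ z] by metis
  define u w where "u = (\<lambda>t. fst (x t))" and "w = (\<lambda>t. snd (x t))"
  have du: "(u has_real_derivative fst (X t (u t, w t))) (at t within {0..T})"
    and dw: "(w has_real_derivative snd (X t (u t, w t))) (at t within {0..T})"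
    if "t \<in> {0..T}" for t
    using bounded_linear.has_vector_derivative[OF bounded_linear_fst dx[OF that]]
      bounded_linear.has_vector_derivative[OF bounded_linear_snd dx[OF that]]
    by (auto simp: u_def w_def has_real_derivative_iff_has_vector_derivative)
  have "\<bar>w t\<bar> \<le> a + 2 * K * T" if t: "t \<in> {0..T}" for t
  proof -
    have "norm (w t - w 0) \<le> K * norm (t - 0)"
      by (rule field_differentiable_bound[OF convex_real_interval(5) dw]) (use t T K in auto)
    also have "\<dots> \<le> K * T" using t K[OF t, of 0] by (auto intro!: mult_left_mono)
    finally show ?thesis using x(1) unfolding C_def w_def by (auto simp: mem_Times_iff)
  qed
  then show ?thesis using that[of u w] du dw x(2) by (auto simp: u_def w_def)
qed

section \<open>A maximum principle for periodic functions\<close>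

text \<open>
  Think of \<open>d\<close> as the difference of two functions and of \<open>e\<close> as the difference of their fluxes,
  which has the sign of \<open>d'\<close> because fluxes increase with the slope. At a positive maximum of \<open>d\<close> over the circle, \<open>e\<close> is nonnegative.
  Just after it \<open>d\<close> is still positive, so \<open>e\<close> increases and is positive, so \<open>d\<close> increases beyond
  its maximum. No second derivative of \<open>d\<close> is involved, and indeed
  \<open>d\<close> need not have one when the flux is a nonlinear function of the slope.
\<close>

lemma periodic_maximum_principle:
  fixes d d' e e' :: "real \<Rightarrow> real"
  assumes T: "T > 0"
    and dd: "\<And>t. t \<in> {0..T} \<Longrightarrow> (d has_real_derivative d' t) (at t within {0..T})"
    and ee: "\<And>t. t \<in> {0..T} \<Longrightarrow> (e has_real_derivative e' t) (at t within {0..T})"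
    and per: "d 0 = d T" "d' T \<le> d' 0"
    and pos: "\<And>t. t \<in> {0..T} \<Longrightarrow> d t > 0 \<Longrightarrow> e' t > 0"
    and sgn: "\<And>t. t \<in> {0..T} \<Longrightarrow> d t > 0 \<Longrightarrow> sgn (e t) = sgn (d' t)"
    and t: "t \<in> {0..T}"
  shows "d t \<le> 0"
proof (rule ccontr)
  assume "\<not> d t \<le> 0"
  have cd: "continuous_on {0..T} d" by (rule DERIV_continuous_on, erule dd)
  obtain m where m: "m \<in> {0..T}" "\<And>s. s \<in> {0..T} \<Longrightarrow> d s \<le> d m"
    using continuous_attains_sup[OF compact_Icc _ cd] T by fastforce
  have dpos: "d m > 0" using m(2)[OF t] \<open>\<not> d t \<le> 0\<close> by simp
  have left: "d' s \<ge> 0" if s: "s \<in> {0<..T}" "d s = d m" for s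
  proof (rule ccontr)
    assume "\<not> d' s \<ge> 0"
    then obtain \<epsilon> where \<epsilon>: "\<epsilon> > 0" "\<And>h. h > 0 \<Longrightarrow> s - h \<in> {0..T} \<Longrightarrow> h < \<epsilon> \<Longrightarrow> d s < d (s - h)"
      using has_real_derivative_neg_dec_left[OF dd[of s]] s by auto
    have "d s < d (s - min s (\<epsilon> / 2))" using \<epsilon>(1) s by (intro \<epsilon>(2)) auto
    moreover have "d (s - min s (\<epsilon> / 2)) \<le> d m" using \<epsilon>(1) s by (intro m(2)) auto
    ultimately show False using s by simp
  qed
  \<comment> \<open>A maximum at \<open>T\<close> is moved to \<open>0\<close>, so that there is room to its right.\<close>
  define t0 where "t0 = (if m = T then 0 else m)"
  have t0: "t0 \<in> {0..<T}" "d t0 = d m" using m(1) T per by (auto simp: t0_def)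
  have t0': "t0 \<in> {0..T}" using t0 by auto
  have "d' t0 \<ge> 0"
  proof (cases "t0 = 0")
    \<comment> \<open>Then \<open>T\<close> is a maximum point as well, and the slope there is at most the slope at \<open>0\<close>.\<close>
    case True
    then have "d T = d m" using t0 per by simp
    then show ?thesis using left[of T] T per True by simp
  qed (use left[of t0] t0 in auto)
  then have e0: "e t0 \<ge> 0" using sgn[of t0] t0 dpos
    by (auto simp: sgn_if split: if_splits)
  obtain \<epsilon> where \<epsilon>: "\<epsilon> > 0" "\<And>s. s \<in> {0..T} \<Longrightarrow> \<bar>s - t0\<bar> < \<epsilon> \<Longrightarrow> \<bar>d s - d t0\<bar> < d m"
    using cd[unfolded continuous_on_iff dist_real_def, rule_format, OF t0' dpos] by blast
  define t1 where "t1 = min T (t0 + \<epsilon> / 2)"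
  have t1: "t0 < t1" "{t0..t1} \<subseteq> {0..T}" using t0 \<epsilon>(1) by (auto simp: t1_def)
  have dp: "d s > 0" if "s \<in> {t0..t1}" for s
  proof -
    have "\<bar>s - t0\<bar> < \<epsilon>" using that \<epsilon>(1) by (auto simp: t1_def)
    moreover have "s \<in> {0..T}" using that t1 by auto
    ultimately show ?thesis using \<epsilon>(2)[of s] t0 by auto
  qed
  have mono: "\<Phi> a < \<Phi> b"
    if "\<And>s. s \<in> {0..T} \<Longrightarrow> (\<Phi> has_real_derivative \<Phi>' s) (at s within {0..T})"
      "\<And>s. s \<in> {a<..<b} \<Longrightarrow> \<Phi>' s > 0" "a < b" "{a..b} \<subseteq> {t0..t1}" for \<Phi> \<Phi>' a b
  proof (rule DERIV_pos_imp_increasing_open[OF \<open>a < b\<close>])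
    show "continuous_on {a..b} \<Phi>"
      using DERIV_continuous_on[of "{0..T}" \<Phi> \<Phi>'] that(1,4) t1(2)
      by (meson continuous_on_subset)
    fix s assume s: "a < s" "s < b"
    have "a \<in> {t0..t1}" "b \<in> {t0..t1}" using that(3,4) by auto
    then have "s \<in> {0<..<T}" using s t0(1) by (auto simp: t1_def)
    then have "at s within {0..T} = at s" by (intro at_within_interior) simp
    then show "\<exists>y. DERIV \<Phi> s :> y \<and> y > 0"
      using that(1)[of s] that(2)[of s] s \<open>s \<in> {0<..<T}\<close> by auto
  qed
  have ep: "e s > 0" if "s \<in> {t0<..t1}" for s
  proof -
    have "e t0 < e s"
      by (rule mono[OF ee]) (use that pos dp t1 in auto)
    then show ?thesis using e0 by simp
  qed
  have "d t0 < d t1"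
  proof (rule mono[OF dd])
    fix s assume s: "s \<in> {t0<..<t1}"
    then have "sgn (e s) = sgn (d' s)" using sgn[of s] dp[of s] t1 by auto
    then show "d' s > 0" using ep[of s] s by (auto simp: sgn_if split: if_splits)
  qed (use t1 in auto)
  moreover have "d t1 \<le> d m" using m(2)[of t1] t1 by auto
  ultimately show False using t0 by simp
qed

section \<open>The inverse of \<open>\<phi>\<close>\<close>

text \<open>
  The inverse of \<open>\<phi> q\<close> for \<open>q > 1\<close>. Splitting the argument into its positive and negative parts keeps the
  bases of the powers nonnegative, so that continuity at \<open>0\<close>, jointly with the exponent, comes
  from the continuity of \<open>powr\<close>.
\<close>

definition \<psi> :: "real \<Rightarrow> real \<Rightarrow> real" where
  "\<psi> q y = max y 0 powr (1 / (q - 1)) - max (- y) 0 powr (1 / (q - 1))"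

lemma \<phi>_pos: "x > 0 \<Longrightarrow> \<phi> q x = x powr (q - 1)"
  using powr_add[of x "q - 2" 1] by (simp add: \<phi>_def)

lemma \<phi>_minus: "\<phi> q (- x) = - \<phi> q x"
  by (simp add: \<phi>_def)

lemma \<psi>_minus: "\<psi> q (- y) = - \<psi> q y"
  by (simp add: \<psi>_def)

lemma \<phi>_\<psi>: assumes "q > 1" shows "\<phi> q (\<psi> q y) = y"
proof -
  have *: "\<phi> q (\<psi> q y) = y" if "y > 0" for y
    using that assms by (simp add: \<psi>_def \<phi>_pos powr_powr)
  consider "y > 0" | "y = 0" | "- y > 0" by linarith
  then show ?thesis
  proof cases
    case 3
    then show ?thesis using *[of "- y"] by (simp add: \<psi>_minus \<phi>_minus)
  qed (use * in \<open>auto simp: \<psi>_def \<phi>_def\<close>)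
qed

lemma \<phi>_strict_mono: assumes "q > 1" "x < y" shows "\<phi> q x < \<phi> q y"
proof -
  have 0: "\<phi> q 0 = 0" by (simp add: \<phi>_def)
  have p: "\<phi> q x > 0" if "x > 0" for x using that by (simp add: \<phi>_pos)
  have *: "\<phi> q x < \<phi> q y" if "0 \<le> x" "x < y" for x y
    using that assms(1) p[of y] 0 by (cases "x = 0") (auto simp: \<phi>_pos powr_less_mono2)
  show ?thesis
  proof (cases "x \<ge> 0")
    case False
    show ?thesis
    proof (cases "y > 0")
      case True
      then show ?thesis using p[of y] p[of "-x"] False by (simp add: \<phi>_minus)
    next
      case 2: False
      then show ?thesis using *[of "-y" "-x"] assms False by (simp add: \<phi>_minus)
    qed
  qed (use * assms in auto)
qed

lemma sgn_\<phi>_diff: "q > 1 \<Longrightarrow> sgn (\<phi> q x - \<phi> q y) = sgn (x - y)"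
  using \<phi>_strict_mono[of q x y] \<phi>_strict_mono[of q y x]
  by (cases x y rule: linorder_cases) auto

lemma sgn_\<psi>: "q > 1 \<Longrightarrow> sgn (\<psi> q y) = sgn y"
  using sgn_\<phi>_diff[of q "\<psi> q y" 0] \<phi>_\<psi>[of q y] by (simp add: \<phi>_def)

lemma continuous_on_\<psi> [continuous_intros]:
  fixes q y :: "'a::topological_space \<Rightarrow> real"
  assumes "continuous_on S q" "continuous_on S y" "\<And>x. x \<in> S \<Longrightarrow> q x > 1"
  shows "continuous_on S (\<lambda>x. \<psi> (q x) (y x))"
  unfolding \<psi>_def
  by (intro continuous_intros continuous_on_powr' assms(1,2)) (auto dest: assms(3))

section \<open>Periodic solutions of Lienard systems\<close>

text \<open>
  The system is the equation \<open>(\<phi> (p t) u' + \<Gamma> t u)' = H t u\<close> in the Lienard variables \<open>u\<close> and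
  \<open>w = \<phi> (p t) u' + \<Gamma> t u\<close>. In these variables the right-hand side does not contain the derivative
  of \<open>\<Gamma>\<close>, so continuity of \<open>\<Gamma>\<close> is enough, and \<open>w\<close> stays bounded because \<open>H\<close> is bounded. This
  is the a priori bound on \<open>u'\<close>.
\<close>

lemma lienard_periodic_solution:
  fixes p :: "real \<Rightarrow> real" and \<Gamma> H :: "real \<Rightarrow> real \<Rightarrow> real"
  assumes T: "T > 0"
    and p: "continuous_on {0..T} p" "\<And>t. t \<in> {0..T} \<Longrightarrow> p t > 1"
    and \<Gamma>: "continuous_on ({0..T} \<times> UNIV) (\<lambda>(t, u). \<Gamma> t u)"
      "\<And>t u. t \<in> {0..T} \<Longrightarrow> \<bar>\<Gamma> t u\<bar> \<le> B"
    and H: "continuous_on ({0..T} \<times> UNIV) (\<lambda>(t, u). H t u)"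
      "\<And>t u. t \<in> {0..T} \<Longrightarrow> \<bar>H t u\<bar> \<le> K"
    and H_pos: "\<And>t u. t \<in> {0..T} \<Longrightarrow> u \<ge> b \<Longrightarrow> H t u > 0"
    and H_neg: "\<And>t u. t \<in> {0..T} \<Longrightarrow> u \<le> -b \<Longrightarrow> H t u < 0"
    and b: "b \<ge> 0"
  obtains u w where "u T = u 0" "w T = w 0"
    "\<And>t. t \<in> {0..T} \<Longrightarrow> (u has_real_derivative \<psi> (p t) (w t - \<Gamma> t (u t))) (at t within {0..T})"
    "\<And>t. t \<in> {0..T} \<Longrightarrow> (w has_real_derivative H t (u t)) (at t within {0..T})"
proof -
  have "B \<ge> 0" "K \<ge> 0" using \<Gamma>(2)[of 0 0] H(2)[of 0 0] T by auto
  define a where "a = B + 1"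
  \<comment> \<open>\<open>\<psi>\<close> is unbounded, so its argument is truncated. The level \<open>S\<close> bounds
    \<open>w - \<Gamma> t u\<close> along the solution, as \<open>\<bar>w\<bar> \<le> a + 2 * K * T\<close>.\<close>
  define S where "S = a + 2 * K * T + B"
  define cl where "cl y = max (- S) (min S y)" for y
  have S: "S > 0" using mult_nonneg_nonneg[OF \<open>K \<ge> 0\<close>, of T] T \<open>B \<ge> 0\<close> by (simp add: S_def a_def)
  define X where "X t z = (\<psi> (p t) (cl (snd z - \<Gamma> t (fst z))), H t (fst z))" for t z
  have "continuous_on ({0..T} \<times> {-S..S}) (\<lambda>z. \<psi> (p (fst z)) (snd z))"
    by (intro continuous_intros continuous_on_compose2[OF p(1)]) (auto intro: p(2))
  then obtain L where L: "\<And>z. z \<in> {0..T} \<times> {-S..S} \<Longrightarrow> norm (\<psi> (p (fst z)) (snd z)) \<le> L"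
    using continuous_on_compact_bound[OF compact_Times[OF compact_Icc compact_Icc]] by blast
  have "continuous_on ({0..T} \<times> (UNIV :: (real \<times> real) set)) (\<lambda>z. X (fst z) (snd z))"
  proof -
    have 1: "continuous_on ({0..T} \<times> (UNIV :: (real \<times> real) set)) (\<lambda>z. Q (fst z) (fst (snd z)))"
      if "continuous_on ({0..T} \<times> UNIV) (\<lambda>(t, u). Q t u)" for Q :: "real \<Rightarrow> real \<Rightarrow> real"
    proof -
      have "continuous_on ({0..T} \<times> (UNIV :: (real \<times> real) set)) (\<lambda>z. (\<lambda>(t, u). Q t u) (fst z, fst (snd z)))"
        by (rule continuous_on_compose2[OF that]) (auto intro!: continuous_intros)
      then show ?thesis by simp
    qed
    show ?thesis unfolding X_def cl_def
      by (intro continuous_intros 1 \<Gamma> H continuous_on_compose2[OF p(1)]) (auto intro: p(2))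
  qed
  then have cont: "continuous_on ({0..T} \<times> UNIV) (\<lambda>(t, z). X t z)"
    by (simp add: case_prod_unfold)
  have sgnX: "sgn (fst (X t (u, w))) = sgn (cl (w - \<Gamma> t u))" if "t \<in> {0..T}" for t u w
    using sgn_\<psi>[OF p(2)[OF that]] by (simp add: X_def)
  obtain u w where uw: "u T = u 0" "w T = w 0"
    "\<And>t. t \<in> {0..T} \<Longrightarrow> (u has_real_derivative fst (X t (u t, w t))) (at t within {0..T})"
    "\<And>t. t \<in> {0..T} \<Longrightarrow> (w has_real_derivative snd (X t (u t, w t))) (at t within {0..T})"
    "\<And>t. t \<in> {0..T} \<Longrightarrow> \<bar>w t\<bar> \<le> a + 2 * K * T"
  proof (rule planar_periodic_solution[OF T cont, of L K b a])
    fix t u w assume t: "t \<in> {0..T}"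
    show "fst (X t (u, w)) > 0" if "w \<ge> a"
    proof -
      have "cl (w - \<Gamma> t u) > 0" using that \<Gamma>(2)[OF t, of u] S by (auto simp: a_def cl_def)
      then show ?thesis using sgnX[OF t] by (metis sgn_greater)
    qed
    show "fst (X t (u, w)) < 0" if "w \<le> -a"
    proof -
      have "cl (w - \<Gamma> t u) < 0" using that \<Gamma>(2)[OF t, of u] S by (auto simp: a_def cl_def)
      then show ?thesis using sgnX[OF t] by (metis sgn_less)
    qed
  next
    fix t and z :: "real \<times> real" assume t: "t \<in> {0..T}"
    show "\<bar>fst (X t z)\<bar> \<le> L" using L[of "(t, cl (snd z - \<Gamma> t (fst z)))"] t S
      by (auto simp: X_def cl_def)
  qed (use H H_pos H_neg b \<open>B \<ge> 0\<close> in \<open>auto simp: X_def a_def\<close>)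
  have "cl (w t - \<Gamma> t (u t)) = w t - \<Gamma> t (u t)" if "t \<in> {0..T}" for t
    using uw(5)[OF that] \<Gamma>(2)[OF that, of "u t"] by (auto simp: cl_def S_def)
  then show ?thesis using that[of u w] uw by (simp add: X_def)
qed

section \<open>Lower and upper solutions\<close>

lemma dI_eq: "(u has_real_derivative u') (at t within {0..T}) \<Longrightarrow> T > 0 \<Longrightarrow> t \<in> {0..T} \<Longrightarrow> dI T u t = u'"
  using vector_derivative_within_cbox[of 0 T t u u'] by (simp add: has_real_derivative_iff_has_vector_derivative)

lemma C1_has_derivative:
  "C1_on_interval T u \<Longrightarrow> t \<in> {0..T} \<Longrightarrow> (u has_real_derivative dI T u t) (at t within {0..T})"
  unfolding C1_on_interval_def has_real_derivative_iff_has_vector_derivative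
  by (meson differentiable_on_def vector_derivative_works)

lemma C1_intro:
  assumes "T > 0" "\<And>t. t \<in> {0..T} \<Longrightarrow> (u has_real_derivative u' t) (at t within {0..T})"
    "continuous_on {0..T} u'"
  shows "C1_on_interval T u"
  unfolding C1_on_interval_def
proof
  show "u differentiable_on {0..T}"
    using assms(2) unfolding differentiable_on_def real_differentiable_def by blast
  show "continuous_on {0..T} (dI T u)"
    using assms(3) by (rule continuous_on_cong[THEN iffD2, rotated 2]) (use dI_eq assms in auto)
qed

lemma primitive_chain:
  fixes f v :: "real \<Rightarrow> real"
  assumes "continuous_on {0..R} f" "v ` S \<subseteq> {0..R}" "t \<in> S"
    "(v has_real_derivative v') (at t within S)"
  shows "((\<lambda>s. integral {0..v s} f) has_real_derivative f (v t) * v') (at t within S)"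
proof -
  have "((\<lambda>y. integral {0..y} f) has_real_derivative f (v t)) (at (v t) within v ` S)"
    by (rule DERIV_subset[OF integral_has_real_derivative[OF assms(1)]]) (use assms(2,3) in auto)
  from DERIV_image_chain[OF this assms(4)] show ?thesis by (simp add: o_def)
qed

theorem theorem3p3:
  fixes T :: real and p f g h \<alpha> \<beta> :: "real \<Rightarrow> real"
  assumes "T > 0"
    and "continuous_on {0..T} p" and "\<forall>t\<in>{0..T}. p t > 1" and "p 0 = p T"
    and "continuous_on {0..} f"
    and "continuous_on {0<..} g"
    and "continuous_on {0..T} h"
    and "lower_solution T p f g h \<alpha>"
    and "upper_solution T p f g h \<beta>"
    and "\<forall>t\<in>{0..T}. \<alpha> t \<le> \<beta> t"
  shows "\<exists>u. is_solution T p f g h u \<and> (\<forall>t\<in>{0..T}. \<alpha> t \<le> u t \<and> u t \<le> \<beta> t)"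
proof -
  note T = assms(1)
  have p: "p t > 1" if "t \<in> {0..T}" for t using assms(3) that by blast
  have le: "\<alpha> t \<le> \<beta> t" if "t \<in> {0..T}" for t using assms(10) that by blast
  note \<alpha> = assms(8)[unfolded lower_solution_def] and \<beta> = assms(9)[unfolded upper_solution_def]
  have d\<alpha>: "(\<alpha> has_real_derivative dI T \<alpha> t) (at t within {0..T})"
    and d\<beta>: "(\<beta> has_real_derivative dI T \<beta> t) (at t within {0..T})"
    and dflux\<alpha>: "(flux T p \<alpha> has_real_derivative dI T (flux T p \<alpha>) t) (at t within {0..T})"
    and dflux\<beta>: "(flux T p \<beta> has_real_derivative dI T (flux T p \<beta>) t) (at t within {0..T})"
    if "t \<in> {0..T}" for t
    using \<alpha> \<beta> C1_has_derivative that by blast+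
  have c\<alpha>: "continuous_on {0..T} \<alpha>" and c\<beta>: "continuous_on {0..T} \<beta>"
    by (rule DERIV_continuous_on, erule d\<alpha> d\<beta>)+
  have ne: "{0..T} \<noteq> {}" using T by simp
  obtain s1 where s1: "s1 \<in> {0..T}" "\<forall>t\<in>{0..T}. \<alpha> s1 \<le> \<alpha> t"
    using continuous_attains_inf[OF compact_Icc ne c\<alpha>] by blast
  obtain s2 where s2: "\<forall>t\<in>{0..T}. \<beta> t \<le> \<beta> s2"
    using continuous_attains_sup[OF compact_Icc ne c\<beta>] by blast
  define m M where "m = \<alpha> s1" and "M = \<beta> s2"
  have m: "m > 0" "\<And>t. t \<in> {0..T} \<Longrightarrow> m \<le> \<alpha> t"
    and M: "\<And>t. t \<in> {0..T} \<Longrightarrow> \<beta> t \<le> M"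
    using s1 s2 \<alpha> unfolding m_def M_def by blast+
  have M0: "M \<ge> 0" using M[of 0] m(2)[of 0] le[of 0] m(1) T by auto
  \<comment> \<open>The coefficients are evaluated at \<open>u\<close> clipped between \<open>\<alpha>\<close> and \<open>\<beta>\<close>, and a restoring
    term in \<open>H\<close> pulls \<open>u\<close> back into this strip.\<close>
  define \<gamma> where "\<gamma> t u = max (\<alpha> t) (min u (\<beta> t))" for t u
  have \<gamma>: "\<gamma> t u \<in> {m..M}" if "t \<in> {0..T}" for t u
    using m(2)[OF that] M[OF that] le[OF that] by (auto simp: \<gamma>_def)
  have \<gamma>0: "\<gamma> t u \<in> {0..M}" if "t \<in> {0..T}" for t u
    using \<gamma>[OF that, of u] m(1) by auto
  have c\<gamma>: "continuous_on ({0..T} \<times> UNIV) (\<lambda>z. \<gamma> (fst z) (snd z))"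
    unfolding \<gamma>_def
    by (intro continuous_intros continuous_on_compose2[OF c\<alpha>] continuous_on_compose2[OF c\<beta>]) auto

  define F where "F y = integral {0..y} f" for y
  have cf: "continuous_on {0..M} f" using assms(5) by (rule continuous_on_subset) auto
  have cF: "continuous_on {0..M} F"
    unfolding F_def by (rule DERIV_continuous_on, erule integral_has_real_derivative[OF cf])
  have cg: "continuous_on {m..M} g" using assms(6) m(1) by (auto elim: continuous_on_subset)
  obtain B where B: "\<And>y. y \<in> {0..M} \<Longrightarrow> norm (F y) \<le> B"
    using continuous_on_compact_bound[OF compact_Icc cF] by blast
  obtain G where G: "\<And>y. y \<in> {m..M} \<Longrightarrow> norm (g y) \<le> G"
    using continuous_on_compact_bound[OF compact_Icc cg] by blast
  obtain h0 where h0: "\<And>t. t \<in> {0..T} \<Longrightarrow> norm (h t) \<le> h0"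
    using continuous_on_compact_bound[OF compact_Icc assms(7)] by blast
  have Gh: "G \<ge> 0" "h0 \<ge> 0"
    using order_trans[OF norm_ge_zero G[OF \<gamma>[of 0 0]]] order_trans[OF norm_ge_zero h0[of 0]] T by auto
  \<comment> \<open>Large enough for the saturated restoring term to outweigh \<open>h\<close> and \<open>g\<close>.\<close>
  define K where "K = h0 + G + 1"
  have K: "K > 0" using Gh by (simp add: K_def)
  define H where "H t u = h t - g (\<gamma> t u) + max (- K) (min K (u - \<gamma> t u))" for t u

  obtain u w where per: "u T = u 0" "w T = w 0"
    and du: "\<And>t. t \<in> {0..T} \<Longrightarrow>
      (u has_real_derivative \<psi> (p t) (w t - F (\<gamma> t (u t)))) (at t within {0..T})"
    and dw: "\<And>t. t \<in> {0..T} \<Longrightarrow> (w has_real_derivative H t (u t)) (at t within {0..T})"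
  proof (rule lienard_periodic_solution[OF T assms(2) p, where B = B and K = "2 * K" and b = "M + K"])
    show "continuous_on ({0..T} \<times> UNIV) (\<lambda>(t, u). F (\<gamma> t u))"
      unfolding case_prod_unfold
      by (rule continuous_on_compose2[OF cF c\<gamma>]) (use \<gamma>0 in auto)
    have "continuous_on ({0..T} \<times> UNIV) (\<lambda>z. g (\<gamma> (fst z) (snd z)))"
      by (rule continuous_on_compose2[OF cg c\<gamma>]) (use \<gamma> in force)
    then show "continuous_on ({0..T} \<times> UNIV) (\<lambda>(t, u). H t u)"
      unfolding case_prod_unfold H_def
      by (intro continuous_intros c\<gamma> continuous_on_compose2[OF assms(7)]) auto
    fix t u assume t: "t \<in> {0..T}"
    note b = \<gamma>[OF t, of u] G[OF \<gamma>[OF t, of u]] h0[OF t] m(1)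
    show "\<bar>F (\<gamma> t u)\<bar> \<le> B" using B[of "\<gamma> t u"] b by auto
    show "\<bar>H t u\<bar> \<le> 2 * K" using b K unfolding H_def K_def by auto
    show "H t u > 0" if "u \<ge> M + K" using b K that unfolding H_def K_def by auto
    show "H t u < 0" if "u \<le> - (M + K)" using b K that M0 unfolding H_def K_def by auto
  qed (use K M0 in auto)

  define u' where "u' t = \<psi> (p t) (w t - F (\<gamma> t (u t)))" for t
  have \<phi>u': "\<phi> (p t) (u' t) = w t - F (\<gamma> t (u t))" if "t \<in> {0..T}" for t
    unfolding u'_def by (rule \<phi>_\<psi>[OF p[OF that]])
  have u'per: "u' T = u' 0" using per assms(4) \<alpha> \<beta> by (simp add: u'_def \<gamma>_def)
  have dF: "((\<lambda>s. F (v s)) has_real_derivative f (v t) * v') (at t within {0..T})"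
    if "\<And>s. s \<in> {0..T} \<Longrightarrow> \<alpha> s \<le> v s \<and> v s \<le> \<beta> s" "t \<in> {0..T}"
      "(v has_real_derivative v') (at t within {0..T})" for v v' t
    unfolding F_def
  proof (rule primitive_chain[OF cf _ that(2,3)])
    have "v s \<in> {0..M}" if "s \<in> {0..T}" for s
      using \<open>\<And>s. s \<in> {0..T} \<Longrightarrow> \<alpha> s \<le> v s \<and> v s \<le> \<beta> s\<close>[OF that] m(1) m(2)[OF that] M[OF that] by auto
    then show "v ` {0..T} \<subseteq> {0..M}" by blast
  qed

  \<comment> \<open>Where \<open>u > \<beta>\<close> the friction term of the modified equation is \<open>(F \<circ> \<beta>)'\<close>, the same as
    that of \<open>\<beta>\<close>, so it cancels from the difference of the two equations.\<close>
  have upper: "u t \<le> \<beta> t" if "t \<in> {0..T}" for t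
  proof -
    have "u t - \<beta> t \<le> 0"
    proof (rule periodic_maximum_principle[OF T _ _ _ _ _ _ that])
      fix s assume s: "s \<in> {0..T}"
      show "((\<lambda>s. u s - \<beta> s) has_real_derivative u' s - dI T \<beta> s) (at s within {0..T})"
        using du[OF s] d\<beta>[OF s] unfolding u'_def by (rule DERIV_diff)
      show "((\<lambda>s. w s - F (\<beta> s) - flux T p \<beta> s) has_real_derivative
          H s (u s) - f (\<beta> s) * dI T \<beta> s - dI T (flux T p \<beta>) s) (at s within {0..T})"
        by (intro DERIV_diff dw dF dflux\<beta> d\<beta> s) (use le in auto)
      assume pos: "u s - \<beta> s > 0"
      then have [simp]: "\<gamma> s (u s) = \<beta> s" using le[OF s] by (simp add: \<gamma>_def)
      have "dI T (flux T p \<beta>) s + f (\<beta> s) * dI T \<beta> s + g (\<beta> s) \<le> h s" using \<beta> s by blast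
      then show "H s (u s) - f (\<beta> s) * dI T \<beta> s - dI T (flux T p \<beta>) s > 0"
        using pos K unfolding H_def by auto
      have "w s - F (\<beta> s) - flux T p \<beta> s = \<phi> (p s) (u' s) - \<phi> (p s) (dI T \<beta> s)"
        using \<phi>u'[OF s] by (simp add: flux_def)
      then show "sgn (w s - F (\<beta> s) - flux T p \<beta> s) = sgn (u' s - dI T \<beta> s)"
        using sgn_\<phi>_diff[OF p[OF s]] by simp
    qed (use per u'per \<beta> in auto)
    then show ?thesis by simp
  qed
  have lower: "\<alpha> t \<le> u t" if "t \<in> {0..T}" for t
  proof -
    have "\<alpha> t - u t \<le> 0"
    proof (rule periodic_maximum_principle[OF T _ _ _ _ _ _ that])
      fix s assume s: "s \<in> {0..T}"
      show "((\<lambda>s. \<alpha> s - u s) has_real_derivative dI T \<alpha> s - u' s) (at s within {0..T})"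
        using d\<alpha>[OF s] du[OF s] unfolding u'_def by (rule DERIV_diff)
      show "((\<lambda>s. flux T p \<alpha> s - (w s - F (\<alpha> s))) has_real_derivative
          dI T (flux T p \<alpha>) s - (H s (u s) - f (\<alpha> s) * dI T \<alpha> s)) (at s within {0..T})"
        by (intro DERIV_diff dw dF dflux\<alpha> d\<alpha> s) (use le in auto)
      assume pos: "\<alpha> s - u s > 0"
      then have [simp]: "\<gamma> s (u s) = \<alpha> s" using le[OF s] by (simp add: \<gamma>_def)
      have "dI T (flux T p \<alpha>) s + f (\<alpha> s) * dI T \<alpha> s + g (\<alpha> s) \<ge> h s" using \<alpha> s by blast
      then show "dI T (flux T p \<alpha>) s - (H s (u s) - f (\<alpha> s) * dI T \<alpha> s) > 0"
        using pos K unfolding H_def by auto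
      have "flux T p \<alpha> s - (w s - F (\<alpha> s)) = \<phi> (p s) (dI T \<alpha> s) - \<phi> (p s) (u' s)"
        using \<phi>u'[OF s] by (simp add: flux_def)
      then show "sgn (flux T p \<alpha> s - (w s - F (\<alpha> s))) = sgn (dI T \<alpha> s - u' s)"
        using sgn_\<phi>_diff[OF p[OF s]] by simp
    qed (use per u'per \<alpha> in auto)
    then show ?thesis by simp
  qed

  \<comment> \<open>Between \<open>\<alpha>\<close> and \<open>\<beta>\<close> the modified equation is the original one.\<close>
  have \<gamma>u: "\<gamma> t (u t) = u t" if "t \<in> {0..T}" for t
    using lower[OF that] upper[OF that] by (simp add: \<gamma>_def)
  have u_range: "u t \<in> {m..M}" if "t \<in> {0..T}" for t using \<gamma>[OF that, of "u t"] \<gamma>u[OF that] by simp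
  have cu: "continuous_on {0..T} u" and cw: "continuous_on {0..T} w"
    by (rule DERIV_continuous_on, erule du dw)+
  have compose_u: "continuous_on {0..T} (\<lambda>t. q (u t))" if "continuous_on {m..M} q" for q :: "real \<Rightarrow> real"
    by (rule continuous_on_compose2[OF that cu]) (use u_range in auto)
  have u'_eq: "u' t = \<psi> (p t) (w t - F (u t))" if "t \<in> {0..T}" for t
    using \<gamma>u[OF that] by (simp add: u'_def)
  have "continuous_on {0..T} (\<lambda>t. \<psi> (p t) (w t - F (u t)))"
    by (intro continuous_intros assms(2) p cw compose_u continuous_on_subset[OF cF]) (use m(1) in auto)
  then have cu': "continuous_on {0..T} u'"
    by (rule continuous_on_cong[THEN iffD2, rotated 2]) (use u'_eq in auto)
  have dIu: "dI T u t = u' t" if "t \<in> {0..T}" for t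
    using du[OF that] T that unfolding u'_def by (rule dI_eq)
  have C1u: "C1_on_interval T u"
    by (rule C1_intro[OF T _ cu']) (use du in \<open>simp add: u'_def\<close>)
  define flux' where "flux' t = h t - g (u t) - f (u t) * u' t" for t
  have dflux: "(flux T p u has_real_derivative flux' t) (at t within {0..T})" if t: "t \<in> {0..T}" for t
  proof -
    have "((\<lambda>s. w s - F (u s)) has_real_derivative flux' t) (at t within {0..T})"
    proof (rule DERIV_cong[OF DERIV_diff[OF dw[OF t] dF[OF _ t du[OF t]]]])
      show "H t (u t) - f (u t) * \<psi> (p t) (w t - F (\<gamma> t (u t))) = flux' t"
        using \<gamma>u[OF t] K by (simp add: H_def flux'_def u'_def)
    qed (use lower upper in blast)
    moreover have "flux T p u s = w s - F (u s)" if "s \<in> {0..T}" for s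
      using \<phi>u'[OF that] \<gamma>u[OF that] dIu[OF that] by (simp add: flux_def)
    ultimately show ?thesis
      unfolding has_real_derivative_iff_has_vector_derivative
      by (rule has_vector_derivative_transform[OF t, rotated])
  qed
  have "continuous_on {0..T} flux'"
    unfolding flux'_def
    by (intro continuous_intros assms(7) compose_u cg cu' continuous_on_subset[OF cf]) (use m(1) in auto)
  then have "C1_on_interval T (flux T p u)"
    using C1_intro[OF T dflux] by blast
  moreover have "dI T (flux T p u) t + f (u t) * dI T u t + g (u t) = h t" if "t \<in> {0..T}" for t
    using dI_eq[OF dflux[OF that] T that] dIu[OF that] by (simp add: flux'_def)
  moreover have "u t > 0" if "t \<in> {0..T}" for t using u_range[OF that] m(1) by auto
  ultimately have "is_solution T p f g h u"
    unfolding is_solution_def using C1u per dIu[of 0] dIu[of T] u'per T by auto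
  then show ?thesis using lower upper by blast
qed

end
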